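(* Let $\mathcal G$ be a finite connected graph with vertex set $V$, $|V|=n$, and edge set $E$, and let $J$ and $\widetilde J$ be two Jacobi matrices on $\mathcal G$ with parameters $\{a_e,b_v\}_{e\in E,v\in V}$ and $\{\widetilde a_e,\widetilde b_v\}_{e\in E,v\in V}$, respectively. Let $\psi$ be the normalized Perron eigenfunction of $J$ and $\widetilde\psi$ the normalized Perron eigenfunction of $\widetilde J$, and let $$S=\max_{e=(v,w)\in E}\frac{a_e\psi_v\psi_w}{\widetilde a_e\widetilde\psi_v\widetilde\psi_w},\qquad I=\min_{v\in V}\frac{\psi_v^2}{\widetilde\psi_v^2}.$$ Then for any $k=1,\dots,n$, $$\lambda_1(J)-\lambda_k(J)\ \le\ \frac{S}{I}\left(\lambda_1(\widetilde J)-\lambda_k(\widetilde J)\right).$$ In particular, if $\psi=c\widetilde\psi$ for some constant $c>0$, then for any $k=1,\dots,n$, $$\min_{e\in E}\frac{a_e}{\widetilde a_e}\left(\lambda_1(\widetilde J)-\lambda_k(\widetilde J)\right)\ \le\ \lambda_1(J)-\lambda_k(J)\ \le\ \max_{e\in E}\frac{a_e}{\widetilde a_e}\left(\lambda_1(\widetilde J)-\lambda_k(\widetilde J)\right).$$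
   Context: Graphs are undirected; multiple edges and loops are allowed; vertices of degree $1$ are not allowed. A Jacobi matrix on a graph with vertex set $V$ and edge set $E$ is given by positive numbers $\{a_e\}_{e\in E}$ and real numbers $\{b_v\}_{v\in V}$, and is the operator on $L^2(V)$ with matrix entries $J_{v,v}=b_v+2\sum_{e\text{ a loop at }v}a_e$; $J_{v,w}=\sum_{e\text{ between }v\text{ and }w}a_e$ (sum over all edges joining $v$ and $w$) if $v\ne w$ are neighbors; and $J_{v,w}=0$ if $v\neq w$ are not neighbors. $\lambda_1(J)\ge\lambda_2(J)\ge\cdots\ge\lambda_n(J)$ are the eigenvalues counted with multiplicity. The normalized Perron eigenfunction of $J$ is the unit eigenvector with positive entries for the top eigenvalue $\lambda_1(J)$. The notation $e=(v,w)$ means that $e$ is an edge connecting $v$ and $w$. *)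

theory Defs
  imports "HOL-Analysis.Analysis" "HOL-Library.Uprod" "HOL-Library.Multiset"
begin

text \<open>
  A finite multigraph, loops and parallel edges allowed. The vertex set is the whole finite type
  \<open>'v\<close> (hence nonempty, of size \<open>CARD('v)\<close>); \<open>E\<close> is the set of
  edges and \<open>ends e\<close> the unordered pair of end points of \<open>e\<close>. An edge
  \<open>e\<close> connects \<open>v\<close> and \<open>w\<close> iff \<open>ends e = Upair v w\<close>; it is a
  loop iff \<open>v = w\<close>. \<open>E\<close> may be empty, which connectedness allows only for the
  one-vertex graph.
\<close>

definition graph_adj :: "'e set \<Rightarrow> ('e \<Rightarrow> 'v uprod) \<Rightarrow> ('v \<times> 'v) set" where
  "graph_adj E ends = {(v, w). \<exists>e\<in>E. ends e = Upair v w}"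

text \<open>A loop contributes 2 to the degree of its vertex.\<close>

definition graph_degree :: "'e set \<Rightarrow> ('e \<Rightarrow> 'v uprod) \<Rightarrow> 'v \<Rightarrow> nat" where
  "graph_degree E ends v =
     (\<Sum>e | e \<in> E \<and> v \<in> set_uprod (ends e). if ends e = Upair v v then 2 else 1)"

locale finite_connected_graph =
  fixes E :: "'e set" and ends :: "'e \<Rightarrow> 'v::finite uprod"
  assumes finite_edges: "finite E"
    and connected: "(v, w) \<in> (graph_adj E ends)\<^sup>*"
    and no_leaves: "graph_degree E ends v \<noteq> 1"

definition jacobi_matrix ::
    "'e set \<Rightarrow> ('e \<Rightarrow> 'v::finite uprod) \<Rightarrow> ('e \<Rightarrow> real) \<Rightarrow> ('v \<Rightarrow> real) \<Rightarrow> real^'v^'v" where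
  "jacobi_matrix E ends a b = (\<chi> v w.
     if v = w then b v + 2 * (\<Sum>e | e \<in> E \<and> ends e = Upair v v. a e)
     else (\<Sum>e | e \<in> E \<and> ends e = Upair v w. a e))"

definition eigenspace :: "real^'n^'n \<Rightarrow> real \<Rightarrow> (real^'n) set" where
  "eigenspace A x = {u. A *v u = x *\<^sub>R u}"

text \<open>
  The real eigenvalues, each repeated according to the dimension of its eigenspace. Jacobi
  matrices are symmetric, so for them there are \<open>CARD('n)\<close> of these and geometric and
  algebraic multiplicity agree.
\<close>

definition eigenvalues_mset :: "real^'n^'n \<Rightarrow> real multiset" where
  "eigenvalues_mset A =
     (\<Sum>x | \<exists>u\<in>eigenspace A x. u \<noteq> 0. replicate_mset (dim (eigenspace A x)) x)"

text \<open>
  The \<open>k\<close>-th largest eigenvalue with multiplicity, counting from \<open>k = 1\<close>; meaningful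
  for \<open>1 \<le> k\<close> up to the number of eigenvalues.
\<close>

definition nth_eigenvalue :: "nat \<Rightarrow> real^'n^'n \<Rightarrow> real" where
  "nth_eigenvalue k A = rev (sorted_list_of_multiset (eigenvalues_mset A)) ! (k - 1)"

definition normalized_perron :: "real^'n^'n \<Rightarrow> real^'n \<Rightarrow> bool" where
  "normalized_perron A u \<longleftrightarrow>
     u \<in> eigenspace A (nth_eigenvalue 1 A) \<and> norm u = 1 \<and> (\<forall>v. u $ v > 0)"

end

theory Submission
  imports Defs
begin

text \<open>
  Write \<open>f = \<psi> g\<close> pointwise. Since \<open>\<psi>\<close> is an eigenvector for the top eigenvalue,
  \<open>\<lambda>\<^sub>1 \<parallel>f\<parallel>\<^sup>2 - \<langle>f, J f\<rangle>\<close> is the sum over the edges \<open>e = (v, w)\<close> of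
  \<open>a\<^sub>e \<psi>\<^sub>v \<psi>\<^sub>w (g\<^sub>v - g\<^sub>w)\<^sup>2\<close>, in which \<open>b\<close> no longer occurs. Keeping \<open>g\<close> and replacing
  \<open>\<psi>\<close> by \<open>\<psi>'\<close> changes this form by a factor of at most \<open>S\<close> and the squared norm by one of at
  least \<open>I\<close>. The multiplication by \<open>\<psi> / \<psi>'\<close> preserves dimensions of subspaces, so the
  max-min principle gives the upper bound; the lower bound for \<open>\<psi> = c \<psi>'\<close> is the upper one
  with the two matrices exchanged.
\<close>

section \<open>Order statistics of a sorted list\<close>

text \<open>Turns a bound on the \<open>k\<close>-th largest entry into a count of the entries that
  are at least \<open>c\<close>, which for eigenvalues will be a dimension. In a nonincreasing list
  these entries form an initial segment; the index is \<open>k - 1\<close> because lists count from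
  0.\<close>

lemma le_nth_antisorted_iff:
  fixes xs :: "'a::linorder list"
  assumes "sorted (rev xs)" and "1 \<le> k" and "k \<le> length xs"
  shows "c \<le> xs ! (k - 1) \<longleftrightarrow> k \<le> length (filter (\<lambda>x. c \<le> x) xs)"
proof
  have anti: "xs ! j \<le> xs ! i" if "i \<le> j" "j < length xs" for i j
    using assms(1) that by (simp add: sorted_rev_nth_mono)
  show "k \<le> length (filter (\<lambda>x. c \<le> x) xs)" if "c \<le> xs ! (k - 1)"
  proof -
    have "c \<le> x" if x: "x \<in> set (take k xs)" for x
    proof -
      obtain i where "i < k" "x = xs ! i"
        using x assms(3) by (auto simp: in_set_conv_nth)
      then show ?thesis
        using anti[of i "k - 1"] assms \<open>c \<le> xs ! (k - 1)\<close> by force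
    qed
    then have "filter (\<lambda>x. c \<le> x) (take k xs) = take k xs"
      by (simp add: filter_id_conv)
    then have "filter (\<lambda>x. c \<le> x) xs = take k xs @ filter (\<lambda>x. c \<le> x) (drop k xs)"
      by (metis append_take_drop_id filter_append)
    then show ?thesis
      using assms(3) by simp
  qed
  show "c \<le> xs ! (k - 1)" if k: "k \<le> length (filter (\<lambda>x. c \<le> x) xs)"
  proof (rule ccontr)
    assume less: "\<not> c \<le> xs ! (k - 1)"
    have "\<not> c \<le> x" if x: "x \<in> set (drop (k - 1) xs)" for x
    proof -
      obtain i where "i < length xs - (k - 1)" "x = drop (k - 1) xs ! i"
        using x by (metis in_set_conv_nth length_drop)
      then have "k - 1 + i < length xs" "x = xs ! (k - 1 + i)"
        by auto
      then show ?thesis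
        using anti[of "k - 1" "k - 1 + i"] less by force
    qed
    then have "filter (\<lambda>x. c \<le> x) (drop (k - 1) xs) = []"
      by (simp add: filter_empty_conv)
    then have "filter (\<lambda>x. c \<le> x) xs = filter (\<lambda>x. c \<le> x) (take (k - 1) xs)"
      by (metis append_Nil2 append_take_drop_id filter_append)
    then have "length (filter (\<lambda>x. c \<le> x) xs) \<le> k - 1"
      by (metis length_filter_le length_take min.cobounded2 order_trans)
    then show False
      using k assms(2) by simp
  qed
qed

section \<open>Symmetric matrices\<close>

lemma symmetric_matrix_inner:
  fixes A :: "real^'n^'n"
  assumes "transpose A = A"
  shows "u \<bullet> (A *v w) = (A *v u) \<bullet> w"
  by (metis assms dot_lmul_matrix transpose_matrix_vector)

lemma subspace_eigenspace: "subspace (eigenspace A x)"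
  by (auto simp: eigenspace_def subspace_def matrix_vector_right_distrib
      matrix_vector_mult_scaleR scaleR_right_distrib)

lemma eigenspace_orthogonal:
  fixes A :: "real^'n^'n"
  assumes "transpose A = A" and "u \<in> eigenspace A x" and "w \<in> eigenspace A y" and "x \<noteq> y"
  shows "u \<bullet> w = 0"
  using symmetric_matrix_inner[OF assms(1), of u w] assms(2-4) by (auto simp: eigenspace_def)

section \<open>Existence of eigenvectors\<close>

text \<open>By compactness the Rayleigh quotient attains its maximum on the unit sphere of
  \<open>T\<close>, and a maximizer is an eigenvector. Working inside an invariant subspace lets
  this be applied to an orthogonal complement.\<close>

lemma symmetric_matrix_eigenvector_in_subspace:
  fixes A :: "real^'n^'n"
  assumes sym: "transpose A = A" and T: "subspace T" and inv: "\<And>u. u \<in> T \<Longrightarrow> A *v u \<in> T"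
    and "\<exists>u\<in>T. u \<noteq> 0"
  shows "\<exists>u\<in>T. u \<noteq> 0 \<and> (\<exists>x. u \<in> eigenspace A x)"
proof -
  have "compact (sphere 0 1 \<inter> T)"
    using T by (intro compact_Int_closed closed_subspace) auto
  moreover obtain z where "z \<in> T" "z \<noteq> 0"
    using assms(4) by auto
  then have "z /\<^sub>R norm z \<in> sphere 0 1 \<inter> T"
    using T by (auto intro: subspace_scale)
  then have "sphere 0 1 \<inter> T \<noteq> {}"
    by blast
  moreover have "continuous_on (sphere 0 1 \<inter> T) (\<lambda>u. u \<bullet> (A *v u))"
    by (intro continuous_intros linear_continuous_on matrix_vector_mul_bounded_linear)
  ultimately obtain u where u: "u \<in> sphere 0 1 \<inter> T"
    and max: "\<And>w. w \<in> sphere 0 1 \<inter> T \<Longrightarrow> w \<bullet> (A *v w) \<le> u \<bullet> (A *v u)"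
    using continuous_attains_sup[of "sphere 0 1 \<inter> T" "\<lambda>u. u \<bullet> (A *v u)"] by blast
  define m where "m = u \<bullet> (A *v u)"
  define Q where "Q w = m * (w \<bullet> w) - w \<bullet> (A *v w)" for w
  have uu: "u \<bullet> u = 1"
    using u by (simp add: norm_eq_1)
  have Q_nonneg: "0 \<le> Q w" if "w \<in> T" for w
  proof (cases "w = 0")
    case False
    have "w /\<^sub>R norm w \<in> sphere 0 1 \<inter> T"
      using T that False by (auto intro: subspace_scale)
    from max[OF this] have "inverse (norm w) * (inverse (norm w) * (w \<bullet> (A *v w))) \<le> m"
      by (simp add: m_def matrix_vector_mult_scaleR)
    then have "w \<bullet> (A *v w) \<le> m * (norm w * norm w)"
      using False by (simp add: field_simps)
    then show ?thesis
      by (simp add: Q_def dot_square_norm power2_eq_square)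
  qed (simp add: Q_def)
  \<comment> \<open>\<open>Q\<close> is nonnegative on \<open>T\<close> and vanishes at \<open>u\<close>, so its derivative at \<open>u\<close> along \<open>r\<close> is zero;
    that derivative is \<open>2 (r \<bullet> r)\<close>.\<close>
  define r where "r = m *\<^sub>R u - A *v u"
  have rT: "r \<in> T"
    unfolding r_def using u T inv by (intro subspace_diff subspace_scale) auto
  have expand: "Q (u + t *\<^sub>R r) = 2 * t * (r \<bullet> r) + t\<^sup>2 * Q r" for t
  proof -
    have "Q (u + t *\<^sub>R r) = Q u + 2 * t * (m * (u \<bullet> r) - (A *v u) \<bullet> r) + t\<^sup>2 * Q r"
      using symmetric_matrix_inner[OF sym, of u r]
      by (simp add: Q_def matrix_vector_right_distrib matrix_vector_mult_scaleR inner_add_left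
          inner_add_right power2_eq_square inner_commute algebra_simps)
    moreover have "Q u = 0"
      by (simp add: Q_def m_def uu)
    moreover have "m * (u \<bullet> r) - (A *v u) \<bullet> r = r \<bullet> r"
      by (metis inner_diff_left inner_scaleR_left r_def)
    ultimately show ?thesis
      by simp
  qed
  have "r \<bullet> r = 0"
  proof (rule ccontr)
    assume "r \<bullet> r \<noteq> 0"
    then have pos: "0 < r \<bullet> r"
      by simp
    \<comment> \<open>The denominator is positive even if \<open>Q r\<close> vanishes, and this
      negative \<open>t\<close> is small enough for the linear term to outweigh the quadratic one,
      which makes \<open>Q (u + t *\<^sub>R r)\<close> negative.\<close>
    define t where "t = - (r \<bullet> r) / (1 + Q r)"
    have "0 < 1 + Q r"
      using Q_nonneg[OF rT] by simp
    then have t: "t < 0" "t * (1 + Q r) = - (r \<bullet> r)"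
      using pos by (simp_all add: t_def field_simps)
    have "0 \<le> Q (u + t *\<^sub>R r)"
      using u rT T by (intro Q_nonneg subspace_add subspace_scale) auto
    also have "\<dots> = t * (2 * (r \<bullet> r) + t * Q r)"
      unfolding expand by (simp add: power2_eq_square algebra_simps)
    also have "2 * (r \<bullet> r) + t * Q r = r \<bullet> r - t"
      using t(2) by (simp add: algebra_simps)
    finally have "0 \<le> t * (r \<bullet> r - t)" .
    moreover have "t * (r \<bullet> r - t) < 0"
      using t(1) pos by (intro mult_neg_pos) linarith+
    ultimately show False
      by simp
  qed
  then have "u \<in> eigenspace A m"
    by (simp add: r_def eigenspace_def)
  then show ?thesis
    using u uu by (intro bexI[of _ u]) auto
qed

lemma symmetric_matrix_eigenvectors_span:
  fixes A :: "real^'n^'n"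
  assumes sym: "transpose A = A"
  shows "span (\<Union>x. eigenspace A x) = UNIV"
proof (rule ccontr)
  let ?V = "\<Union>x. eigenspace A x"
  \<comment> \<open>The orthogonal complement of the eigenvectors is invariant, so if nonzero it contains one of them.\<close>
  define T where "T = {w. \<forall>u\<in>?V. u \<bullet> w = 0}"
  assume "span ?V \<noteq> UNIV"
  then obtain z where "z \<noteq> 0" "\<And>u. u \<in> span ?V \<Longrightarrow> orthogonal z u"
    using orthogonal_to_subspace_exists_gen[of ?V UNIV] by auto
  then have "z \<in> T"
    by (auto simp: T_def orthogonal_def inner_commute intro: span_base)
  moreover have "subspace T"
    by (auto simp: T_def subspace_def inner_add_right)
  moreover have "A *v w \<in> T" if "w \<in> T" for w
    using that by (auto simp: T_def symmetric_matrix_inner[OF sym] eigenspace_def)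
  ultimately obtain u x where "u \<in> T" "u \<noteq> 0" "u \<in> eigenspace A x"
    using symmetric_matrix_eigenvector_in_subspace[OF sym, of T] \<open>z \<noteq> 0\<close> by blast
  then show False
    by (force simp: T_def)
qed

section \<open>Multiplicities and dimensions\<close>

text \<open>Eigenspaces for distinct eigenvalues are orthogonal, so their dimensions add. The union
  can stay unspanned because \<open>dim\<close> of a set is that of its span.\<close>

lemma dim_Union_eigenspaces:
  fixes A :: "real^'n^'n"
  assumes "transpose A = A" and "finite L"
  shows "dim (\<Union>x\<in>L. eigenspace A x) = (\<Sum>x\<in>L. dim (eigenspace A x))"
  using assms(2)
proof (induction L rule: finite_induct)
  case (insert y L)
  have "dim (eigenspace A y \<union> (\<Union>x\<in>L. eigenspace A x))
      = dim (eigenspace A y) + dim (\<Union>x\<in>L. eigenspace A x)"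
    using insert.hyps by (intro dim_orthogonal_sum) (auto intro: eigenspace_orthogonal[OF assms(1)])
  then show ?case
    using insert by simp
qed simp

definition spectrum :: "real^'n^'n \<Rightarrow> real set" where
  "spectrum A = {x. \<exists>u\<in>eigenspace A x. u \<noteq> 0}"

text \<open>Too many distinct eigenvalues would give orthogonal nonzero eigenspaces of total
  dimension beyond that of the space. Finiteness makes the sum that defines
  \<open>eigenvalues_mset\<close> a genuine one.\<close>

lemma finite_spectrum:
  fixes A :: "real^'n^'n"
  assumes "transpose A = A"
  shows "finite (spectrum A)"
proof (rule ccontr)
  assume "infinite (spectrum A)"
  then obtain L where L: "finite L" "card L = Suc (CARD('n))" "L \<subseteq> spectrum A"
    using infinite_arbitrarily_large by blast
  have "1 \<le> dim (eigenspace A x)" if "x \<in> L" for x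
  proof -
    have "dim (eigenspace A x) \<noteq> 0"
      using that L(3) by (auto simp: spectrum_def)
    then show ?thesis
      by linarith
  qed
  then have "card L \<le> dim (\<Union>x\<in>L. eigenspace A x)"
    unfolding dim_Union_eigenspaces[OF assms L(1)]
    using sum_mono[of L "\<lambda>_. 1" "\<lambda>x. dim (eigenspace A x)"] by simp
  also have "\<dots> \<le> CARD('n)"
    using dim_subset_UNIV[of "\<Union>x\<in>L. eigenspace A x"] by simp
  finally show False
    using L(2) by simp
qed

text \<open>For symmetric \<open>A\<close>, the range of the spectral projection onto the
  eigenvalues that satisfy \<open>P\<close>.\<close>

definition spectral_subspace :: "real^'n^'n \<Rightarrow> (real \<Rightarrow> bool) \<Rightarrow> (real^'n) set" where
  "spectral_subspace A P = span (\<Union>x\<in>{x \<in> spectrum A. P x}. eigenspace A x)"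

text \<open>Both sides equal the sum of the dimensions of the eigenspaces over the eigenvalues
  satisfying \<open>P\<close>. This links counting in the multiset to dimensions of
  subspaces.\<close>

lemma dim_spectral_subspace:
  fixes A :: "real^'n^'n"
  assumes "transpose A = A"
  shows "dim (spectral_subspace A P) = size (filter_mset P (eigenvalues_mset A))"
proof -
  have fin: "finite (spectrum A)"
    using finite_spectrum[OF assms] .
  have "size (filter_mset P (\<Sum>x\<in>L. replicate_mset (f x) x)) = (\<Sum>x\<in>{x \<in> L. P x}. f x)"
    if "finite L" for f and L :: "real set"
    using that
  proof (induction L rule: finite_induct)
    case (insert y L)
    have *: "{x. (x = y \<or> x \<in> L) \<and> P x} = (if P y then insert y {x \<in> L. P x} else {x \<in> L. P x})"
      by auto
    have "filter_mset P (replicate_mset (f y) y) = (if P y then replicate_mset (f y) y else {#})"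
      by (auto simp: filter_mset_eq_conv intro!: filter_mset_cong0 in_replicate_mset)
    with insert show ?case
      by (simp add: *)
  qed simp
  from this[OF fin] show ?thesis
    using fin unfolding spectral_subspace_def dim_span eigenvalues_mset_def
    by (subst dim_Union_eigenspaces[OF assms]) (simp_all add: spectrum_def)
qed

lemma size_eigenvalues_mset:
  fixes A :: "real^'n^'n"
  assumes "transpose A = A"
  shows "size (eigenvalues_mset A) = CARD('n)"
proof -
  \<comment> \<open>Outside the spectrum an eigenspace is \<open>{0}\<close>, so restricting the
    union to the spectrum does not change its span.\<close>
  have "eigenspace A x \<subseteq> insert 0 (\<Union>x\<in>spectrum A. eigenspace A x)" for x
    by (auto simp: spectrum_def)
  then have "(\<Union>x. eigenspace A x) \<subseteq> span (\<Union>x\<in>spectrum A. eigenspace A x)"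
    using span_superset[of "\<Union>x\<in>spectrum A. eigenspace A x"] span_zero by blast
  then have "span (\<Union>x. eigenspace A x) \<subseteq> spectral_subspace A (\<lambda>_. True)"
    unfolding spectral_subspace_def by (simp add: span_minimal)
  then have "spectral_subspace A (\<lambda>_. True) = UNIV"
    using symmetric_matrix_eigenvectors_span[OF assms] by blast
  then show ?thesis
    using dim_spectral_subspace[OF assms, of "\<lambda>_. True"] by (simp add: dim_UNIV)
qed

section \<open>Quadratic form bounds on spectral subspaces\<close>

text \<open>The orthogonal eigencomponents \<open>f x\<close> diagonalize the squared norm and the
  quadratic form of \<open>A\<close> at once, so the two can be compared eigenvalue by
  eigenvalue.\<close>

lemma spectral_subspace_decomposition:
  fixes A :: "real^'n^'n"
  assumes sym: "transpose A = A" and "u \<in> spectral_subspace A P"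
  shows "\<exists>f. u = (\<Sum>x\<in>{x \<in> spectrum A. P x}. f x) \<and>
    u \<bullet> u = (\<Sum>x\<in>{x \<in> spectrum A. P x}. f x \<bullet> f x) \<and>
    u \<bullet> (A *v u) = (\<Sum>x\<in>{x \<in> spectrum A. P x}. x * (f x \<bullet> f x))"
proof -
  let ?L = "{x \<in> spectrum A. P x}"
  have fin: "finite ?L"
    using finite_spectrum[OF sym] by simp
  \<comment> \<open>The sums of one vector from each eigenspace form a subspace that contains all
    these eigenspaces, hence their span.\<close>
  define D where "D = {u. \<exists>f. (\<forall>x. f x \<in> eigenspace A x) \<and> u = (\<Sum>x\<in>?L. f x)}"
  have "subspace D"
    unfolding subspace_def
  proof (intro conjI ballI allI)
    show "0 \<in> D"
      unfolding D_def
      by (intro CollectI exI[of _ "\<lambda>_. 0"]) (simp add: subspace_0[OF subspace_eigenspace])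
    show "v + w \<in> D" if vw: "v \<in> D" "w \<in> D" for v w
    proof -
      obtain f g where "\<forall>x. f x \<in> eigenspace A x" "v = (\<Sum>x\<in>?L. f x)"
        "\<forall>x. g x \<in> eigenspace A x" "w = (\<Sum>x\<in>?L. g x)"
        using vw by (auto simp: D_def)
      then show ?thesis
        unfolding D_def
        by (intro CollectI exI[of _ "\<lambda>x. f x + g x"])
          (simp add: subspace_add[OF subspace_eigenspace] sum.distrib)
    qed
    show "c *\<^sub>R v \<in> D" if v: "v \<in> D" for c v
    proof -
      obtain f where "\<forall>x. f x \<in> eigenspace A x" "v = (\<Sum>x\<in>?L. f x)"
        using v by (auto simp: D_def)
      then show ?thesis
        unfolding D_def
        by (intro CollectI exI[of _ "\<lambda>x. c *\<^sub>R f x"])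
          (simp add: subspace_scale[OF subspace_eigenspace] scaleR_sum_right)
    qed
  qed
  moreover have "eigenspace A y \<subseteq> D" if "y \<in> ?L" for y
  proof
    fix v assume "v \<in> eigenspace A y"
    then show "v \<in> D"
      unfolding D_def using that fin
      by (intro CollectI exI[of _ "\<lambda>x. if x = y then v else 0"])
        (auto simp: subspace_0[OF subspace_eigenspace])
  qed
  ultimately have "spectral_subspace A P \<subseteq> D"
    unfolding spectral_subspace_def by (intro span_minimal) auto
  then obtain f where f: "\<And>x. f x \<in> eigenspace A x" "u = (\<Sum>x\<in>?L. f x)"
    using assms(2) by (auto simp: D_def)
  have Af: "A *v f x = x *\<^sub>R f x" for x
    using f(1) by (simp add: eigenspace_def)
  have ortho: "f x \<bullet> f y = (if x = y then f x \<bullet> f x else 0)" for x y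
    using eigenspace_orthogonal[OF sym f(1) f(1)] by simp
  have "u \<bullet> u = (\<Sum>x\<in>?L. \<Sum>y\<in>?L. f x \<bullet> f y)"
    by (subst (1 2) f(2)) (simp only: inner_sum_left inner_sum_right, rule sum.swap)
  also have "\<dots> = (\<Sum>x\<in>?L. \<Sum>y\<in>?L. if x = y then f x \<bullet> f x else 0)"
    by (subst ortho) (rule refl)
  also have "\<dots> = (\<Sum>x\<in>?L. f x \<bullet> f x)"
    using fin by simp
  finally have uu: "u \<bullet> u = (\<Sum>x\<in>?L. f x \<bullet> f x)" .
  have "A *v u = (\<Sum>x\<in>?L. x *\<^sub>R f x)"
    unfolding f(2) using linear_sum[OF matrix_vector_mul_linear, of A f ?L] by (simp add: Af)
  then have "u \<bullet> (A *v u) = (\<Sum>x\<in>?L. f x) \<bullet> (\<Sum>x\<in>?L. x *\<^sub>R f x)"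
    using f(2) by simp
  also have "\<dots> = (\<Sum>x\<in>?L. \<Sum>y\<in>?L. y * (f x \<bullet> f y))"
    unfolding inner_sum_left inner_sum_right inner_scaleR_right sum_distrib_left by (rule sum.swap)
  also have "\<dots> = (\<Sum>x\<in>?L. \<Sum>y\<in>?L. if x = y then x * (f x \<bullet> f x) else 0)"
    by (intro sum.cong refl) (subst ortho, simp)
  also have "\<dots> = (\<Sum>x\<in>?L. x * (f x \<bullet> f x))"
    using fin by simp
  finally show ?thesis
    using f(2) uu by blast
qed

lemma spectral_subspace_ge:
  fixes A :: "real^'n^'n"
  assumes "transpose A = A" and "u \<in> spectral_subspace A (\<lambda>x. c \<le> x)"
  shows "c * (u \<bullet> u) \<le> u \<bullet> (A *v u)"
proof -
  let ?L = "{x \<in> spectrum A. c \<le> x}"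
  obtain f :: "real \<Rightarrow> real^'n" where f: "u \<bullet> u = (\<Sum>x\<in>?L. f x \<bullet> f x)"
    "u \<bullet> (A *v u) = (\<Sum>x\<in>?L. x * (f x \<bullet> f x))"
    using spectral_subspace_decomposition[OF assms] by blast
  show ?thesis
    unfolding f sum_distrib_left by (intro sum_mono mult_right_mono) auto
qed

lemma spectral_subspace_less:
  fixes A :: "real^'n^'n"
  assumes "transpose A = A" and "u \<in> spectral_subspace A (\<lambda>x. x < c)" and "u \<noteq> 0"
  shows "u \<bullet> (A *v u) < c * (u \<bullet> u)"
proof -
  let ?L = "{x \<in> spectrum A. x < c}"
  obtain f where f: "u = (\<Sum>x\<in>?L. f x)" "u \<bullet> u = (\<Sum>x\<in>?L. f x \<bullet> f x)"
    "u \<bullet> (A *v u) = (\<Sum>x\<in>?L. x * (f x \<bullet> f x))"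
    using spectral_subspace_decomposition[OF assms(1,2)] by blast
  \<comment> \<open>A nonzero vector has a nonzero component, and the term of that component makes
    the inequality strict.\<close>
  obtain y where y: "y \<in> ?L" "f y \<noteq> 0"
    using f(1) assms(3) by (metis (no_types, lifting) sum.neutral)
  have "(\<Sum>x\<in>?L. x * (f x \<bullet> f x)) < (\<Sum>x\<in>?L. c * (f x \<bullet> f x))"
  proof (rule sum_strict_mono_ex1)
    show "finite ?L"
      using finite_spectrum[OF assms(1)] by simp
    show "\<forall>x\<in>?L. x * (f x \<bullet> f x) \<le> c * (f x \<bullet> f x)"
      by (auto intro: mult_right_mono)
    show "\<exists>x\<in>?L. x * (f x \<bullet> f x) < c * (f x \<bullet> f x)"
      using y by (intro bexI[of _ y]) (auto intro: mult_strict_right_mono)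
  qed
  then show ?thesis
    by (simp add: f(2,3) sum_distrib_left)
qed

section \<open>The max-min principle\<close>

lemma le_nth_eigenvalue_iff_size:
  fixes A :: "real^'n^'n"
  assumes "transpose A = A" and "k \<in> {1..CARD('n)}"
  shows "c \<le> nth_eigenvalue k A \<longleftrightarrow> k \<le> size (filter_mset (\<lambda>x. c \<le> x) (eigenvalues_mset A))"
proof -
  let ?xs = "sorted_list_of_multiset (eigenvalues_mset A)"
  have M: "mset ?xs = eigenvalues_mset A"
    by simp
  then have "length ?xs = CARD('n)"
    using size_eigenvalues_mset[OF assms(1)] by (metis size_mset)
  moreover have "size (filter_mset (\<lambda>x. c \<le> x) (eigenvalues_mset A))
      = length (filter (\<lambda>x. c \<le> x) (rev ?xs))"
    by (metis M mset_filter mset_rev size_mset)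
  ultimately show ?thesis
    using le_nth_antisorted_iff[of "rev ?xs" k c] assms(2) by (simp add: nth_eigenvalue_def)
qed

text \<open>The Courant-Fischer principle, phrased as a test at each level \<open>c\<close>.
  Forwards, the spectral subspace for eigenvalues at least \<open>c\<close> is a witness. Backwards,
  \<open>W\<close> meets the spectral subspace for eigenvalues below \<open>c\<close> only in 0, so
  counting dimensions leaves at least \<open>k\<close> eigenvalues that are at least
  \<open>c\<close>.\<close>

lemma le_nth_eigenvalue_iff:
  fixes A :: "real^'n^'n"
  assumes sym: "transpose A = A" and k: "k \<in> {1..CARD('n)}"
  shows "c \<le> nth_eigenvalue k A \<longleftrightarrow>
    (\<exists>W. subspace W \<and> k \<le> dim W \<and> (\<forall>u\<in>W. c * (u \<bullet> u) \<le> u \<bullet> (A *v u)))"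
proof
  let ?M = "eigenvalues_mset A"
  let ?U = "spectral_subspace A (\<lambda>x. c \<le> x)"
  let ?U' = "spectral_subspace A (\<lambda>x. x < c)"
  have sub: "subspace ?U" "subspace ?U'"
    by (simp_all add: spectral_subspace_def)
  show "\<exists>W. subspace W \<and> k \<le> dim W \<and> (\<forall>u\<in>W. c * (u \<bullet> u) \<le> u \<bullet> (A *v u))"
    if "c \<le> nth_eigenvalue k A"
    using that sub(1) spectral_subspace_ge[OF sym]
    by (intro exI[of _ ?U]) (simp add: le_nth_eigenvalue_iff_size[OF sym k] dim_spectral_subspace[OF sym])
  assume "\<exists>W. subspace W \<and> k \<le> dim W \<and> (\<forall>u\<in>W. c * (u \<bullet> u) \<le> u \<bullet> (A *v u))"
  then obtain W where W: "subspace W" "k \<le> dim W" "\<And>u. u \<in> W \<Longrightarrow> c * (u \<bullet> u) \<le> u \<bullet> (A *v u)"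
    by blast
  have "W \<inter> ?U' \<subseteq> {0}"
    using W(3) spectral_subspace_less[OF sym] by (metis IntE insertI1 not_le subsetI)
  then have "dim (W \<inter> ?U') = 0"
    by simp
  then have "dim W + dim ?U' = dim {x + y |x y. x \<in> W \<and> y \<in> ?U'}"
    using dim_sums_Int[OF W(1) sub(2)] by linarith
  also have "\<dots> \<le> CARD('n)"
    using dim_subset_UNIV[of "{x + y |x y. x \<in> W \<and> y \<in> ?U'}"] by simp
  also have "\<dots> = size (filter_mset (\<lambda>x. c \<le> x) ?M) + dim ?U'"
  proof -
    have "?M = filter_mset (\<lambda>x. c \<le> x) ?M + filter_mset (\<lambda>x. x < c) ?M"
      using multiset_partition[of ?M "\<lambda>x. c \<le> x"] by (simp add: not_le)
    then have "size ?M = size (filter_mset (\<lambda>x. c \<le> x) ?M) + size (filter_mset (\<lambda>x. x < c) ?M)"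
      by (metis size_union)
    then show ?thesis
      by (simp add: size_eigenvalues_mset[OF sym] dim_spectral_subspace[OF sym])
  qed
  finally show "c \<le> nth_eigenvalue k A"
    using W(2) by (simp add: le_nth_eigenvalue_iff_size[OF sym k])
qed

lemma nth_eigenvalue_le_first:
  fixes A :: "real^'n^'n"
  assumes "transpose A = A" and "k \<in> {1..CARD('n)}"
  shows "nth_eigenvalue k A \<le> nth_eigenvalue 1 A"
  using le_nth_eigenvalue_iff_size[OF assms, of "nth_eigenvalue k A"]
    le_nth_eigenvalue_iff_size[OF assms(1), of 1 "nth_eigenvalue k A"] assms(2)
  by simp

section \<open>The ground state representation\<close>

text \<open>By the eigenvector equation the symmetric weights \<open>K i j\<close> have row sums
  \<open>x * (\<psi> $ i)\<^sup>2\<close>, so the left side is the Dirichlet form of these weights.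
  Each unordered pair is counted twice, hence the division by 2, and diagonal terms vanish.\<close>

lemma ground_state_representation:
  fixes A :: "real^'n^'n"
  assumes sym: "transpose A = A" and psi: "A *v \<psi> = x *\<^sub>R \<psi>"
  shows "x * ((\<chi> i. \<psi> $ i * g i) \<bullet> (\<chi> i. \<psi> $ i * g i))
      - (\<chi> i. \<psi> $ i * g i) \<bullet> (A *v (\<chi> i. \<psi> $ i * g i))
    = (\<Sum>i\<in>UNIV. \<Sum>j\<in>UNIV. A $ i $ j * \<psi> $ i * \<psi> $ j * (g i - g j)\<^sup>2) / 2"
proof -
  define K where "K i j = A $ i $ j * \<psi> $ i * \<psi> $ j" for i j
  have K_commute: "K i j = K j i" for i j
  proof -
    have "A $ i $ j = A $ j $ i"
      by (metis sym transpose_def vec_lambda_beta)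
    then show ?thesis
      by (simp add: K_def)
  qed
  have row: "(\<Sum>j\<in>UNIV. A $ i $ j * \<psi> $ j) = x * \<psi> $ i" for i
    using arg_cong[OF psi, of "\<lambda>u. u $ i"] by (simp add: matrix_vector_mult_def)
  have 1: "x * ((\<chi> i. \<psi> $ i * g i) \<bullet> (\<chi> i. \<psi> $ i * g i)) = (\<Sum>i\<in>UNIV. \<Sum>j\<in>UNIV. K i j * (g i)\<^sup>2)"
  proof -
    have "(\<Sum>j\<in>UNIV. K i j * (g i)\<^sup>2) = x * (\<psi> $ i * g i * (\<psi> $ i * g i))" for i
    proof -
      have "(\<Sum>j\<in>UNIV. K i j * (g i)\<^sup>2) = (\<Sum>j\<in>UNIV. A $ i $ j * \<psi> $ j) * (\<psi> $ i * (g i)\<^sup>2)"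
        unfolding sum_distrib_right by (simp add: K_def mult_ac)
      then show ?thesis
        unfolding row by (simp add: power2_eq_square mult_ac)
    qed
    then show ?thesis
      by (simp add: inner_vec_def sum_distrib_left)
  qed
  \<comment> \<open>By symmetry of \<open>K\<close> the two square terms in the expansion of
    \<open>(g i - g j)\<^sup>2\<close> contribute equally, each giving the norm term.\<close>
  have 2: "(\<Sum>i\<in>UNIV. \<Sum>j\<in>UNIV. K i j * (g i)\<^sup>2) = (\<Sum>i\<in>UNIV. \<Sum>j\<in>UNIV. K i j * (g j)\<^sup>2)"
    by (subst sum.swap) (simp add: K_commute)
  have 3: "(\<chi> i. \<psi> $ i * g i) \<bullet> (A *v (\<chi> i. \<psi> $ i * g i)) = (\<Sum>i\<in>UNIV. \<Sum>j\<in>UNIV. K i j * (g i * g j))"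
    by (simp add: inner_vec_def matrix_vector_mult_def sum_distrib_left K_def mult_ac)
  have "(\<Sum>i\<in>UNIV. \<Sum>j\<in>UNIV. K i j * (g i - g j)\<^sup>2)
      = (\<Sum>i\<in>UNIV. \<Sum>j\<in>UNIV. K i j * (g i)\<^sup>2) + (\<Sum>i\<in>UNIV. \<Sum>j\<in>UNIV. K i j * (g j)\<^sup>2)
        - 2 * (\<Sum>i\<in>UNIV. \<Sum>j\<in>UNIV. K i j * (g i * g j))"
    by (simp add: sum_distrib_left power2_diff algebra_simps sum.distrib sum_subtractf)
  then show ?thesis
    using 1 2 3 unfolding K_def[symmetric] by simp
qed

section \<open>Comparison of spectral gaps\<close>

text \<open>A subspace that is optimal for \<open>A'\<close> is carried to a test subspace for
  \<open>A\<close>. Only entries with \<open>i \<noteq> j\<close> are compared, since the diagonal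
  drops out of the ground state representation.\<close>

lemma spectral_gap_comparison:
  fixes A A' :: "real^'n^'n"
  assumes sym: "transpose A = A" "transpose A' = A'"
    and psi: "A *v \<psi> = nth_eigenvalue 1 A *\<^sub>R \<psi>" "\<And>i. \<psi> $ i > 0"
    and psi': "A' *v \<psi>' = nth_eigenvalue 1 A' *\<^sub>R \<psi>'" "\<And>i. \<psi>' $ i > 0"
    and S: "0 \<le> S" "\<And>i j. i \<noteq> j \<Longrightarrow> A $ i $ j * \<psi> $ i * \<psi> $ j \<le> S * (A' $ i $ j * \<psi>' $ i * \<psi>' $ j)"
    and I: "0 < I" "\<And>i. I * (\<psi>' $ i)\<^sup>2 \<le> (\<psi> $ i)\<^sup>2"
    and k: "k \<in> {1..CARD('n)}"
  shows "nth_eigenvalue 1 A - nth_eigenvalue k A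
    \<le> S / I * (nth_eigenvalue 1 A' - nth_eigenvalue k A')"
proof -
  define d where "d = nth_eigenvalue 1 A' - nth_eigenvalue k A'"
  have d: "0 \<le> d"
    using nth_eigenvalue_le_first[OF sym(2) k] by (simp add: d_def)
  \<comment> \<open>Pointwise multiplication by \<psi> / \<psi>', which is injective because both
    vectors have positive entries.\<close>
  define D where "D u = (\<chi> i. \<psi> $ i * (u $ i / \<psi>' $ i))" for u
  have "linear D"
    by (intro linearI) (auto simp: D_def vec_eq_iff field_simps add_divide_distrib)
  moreover have "inj D"
  proof (rule injI)
    fix u w
    assume "D u = D w"
    moreover have "\<psi> $ i \<noteq> 0" "\<psi>' $ i \<noteq> 0" for i
      using psi(2)[of i] psi'(2)[of i] by auto
    ultimately show "u = w"
      by (simp add: D_def vec_eq_iff)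
  qed
  moreover obtain W where W: "subspace W" "k \<le> dim W"
    "\<And>u. u \<in> W \<Longrightarrow> nth_eigenvalue k A' * (u \<bullet> u) \<le> u \<bullet> (A' *v u)"
    using le_nth_eigenvalue_iff[OF sym(2) k, of "nth_eigenvalue k A'"] by auto
  ultimately have DW: "subspace (D ` W)" "k \<le> dim (D ` W)"
    by (auto simp: linear_subspace_image dim_image_eq inj_on_subset)
  have "(nth_eigenvalue 1 A - S / I * d) * (D u \<bullet> D u) \<le> D u \<bullet> (A *v D u)" if "u \<in> W" for u
  proof -
    \<comment> \<open>The common factor: \<open>u\<close> is \<psi>' times \<open>g\<close> and
      \<open>D u\<close> is \<psi> times \<open>g\<close>, so their ground state representations
      differ only in the weights.\<close>
    define g where "g i = u $ i / \<psi>' $ i" for i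
    have u: "u = (\<chi> i. \<psi>' $ i * g i)"
      using psi'(2) by (simp add: vec_eq_iff g_def less_imp_neq[THEN not_sym])
    have Du: "D u = (\<chi> i. \<psi> $ i * g i)"
      by (simp add: D_def g_def)
    have "nth_eigenvalue 1 A * (D u \<bullet> D u) - D u \<bullet> (A *v D u)
        = (\<Sum>i\<in>UNIV. \<Sum>j\<in>UNIV. A $ i $ j * \<psi> $ i * \<psi> $ j * (g i - g j)\<^sup>2) / 2"
      unfolding Du by (rule ground_state_representation[OF sym(1) psi(1)])
    also have "\<dots> \<le> (\<Sum>i\<in>UNIV. \<Sum>j\<in>UNIV. S * (A' $ i $ j * \<psi>' $ i * \<psi>' $ j) * (g i - g j)\<^sup>2) / 2"
    proof (intro divide_right_mono sum_mono)
      \<comment> \<open>For \<open>i = j\<close> both sides are 0 because of the factor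
        \<open>(g i - g j)\<^sup>2\<close>.\<close>
      show "A $ i $ j * \<psi> $ i * \<psi> $ j * (g i - g j)\<^sup>2
          \<le> S * (A' $ i $ j * \<psi>' $ i * \<psi>' $ j) * (g i - g j)\<^sup>2" for i j
        using S(2)[of i j] by (cases "i = j") (auto intro: mult_right_mono)
    qed simp
    also have "\<dots> = S * ((\<Sum>i\<in>UNIV. \<Sum>j\<in>UNIV. A' $ i $ j * \<psi>' $ i * \<psi>' $ j * (g i - g j)\<^sup>2) / 2)"
      by (simp add: sum_distrib_left mult_ac)
    also have "\<dots> = S * (nth_eigenvalue 1 A' * (u \<bullet> u) - u \<bullet> (A' *v u))"
      unfolding u by (subst ground_state_representation[OF sym(2) psi'(1)]) (rule refl)
    \<comment> \<open>Membership of \<open>u\<close> in \<open>W\<close> bounds its form by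
      \<open>d\<close> times its squared norm.\<close>
    also have "\<dots> \<le> S * (d * (u \<bullet> u))"
      using S(1) W(3)[OF that] by (intro mult_left_mono) (simp_all add: d_def algebra_simps)
    also have "\<dots> \<le> S * (d * (D u \<bullet> D u / I))"
    proof -
      have "I * (u \<bullet> u) \<le> D u \<bullet> D u"
      proof -
        have "I * ((\<psi>' $ i)\<^sup>2 * (g i)\<^sup>2) \<le> (\<psi> $ i)\<^sup>2 * (g i)\<^sup>2" for i
          using mult_right_mono[OF I(2)[of i], of "(g i)\<^sup>2"] by (simp add: mult_ac)
        then show ?thesis
          unfolding Du unfolding u
          by (auto simp: inner_vec_def sum_distrib_left power2_eq_square mult_ac intro!: sum_mono)
      qed
      then have "u \<bullet> u \<le> D u \<bullet> D u / I"
        using I(1) by (simp add: field_simps)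
      then show ?thesis
        using S(1) d by (intro mult_left_mono)
    qed
    finally show ?thesis
      by (simp add: algebra_simps)
  qed
  \<comment> \<open>The image of \<open>W\<close> under \<open>D\<close> is the test subspace for
    \<open>A\<close> at this level.\<close>
  then have "nth_eigenvalue 1 A - S / I * d \<le> nth_eigenvalue k A"
    using DW unfolding le_nth_eigenvalue_iff[OF sym(1) k] by blast
  then show ?thesis
    by (simp add: d_def)
qed

section \<open>Jacobi matrices\<close>

lemma transpose_jacobi_matrix: "transpose (jacobi_matrix E ends a b) = jacobi_matrix E ends a b"
proof -
  have "Upair v w = Upair w v" for v w :: 'v
    by (simp add: Upair_inject)
  then have "{e \<in> E. ends e = Upair v w} = {e \<in> E. ends e = Upair w v}" for v w
    by metis
  then show ?thesis
    by (auto simp: transpose_def jacobi_matrix_def vec_eq_iff intro: arg_cong[of _ _ "sum a"])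
qed

text \<open>Taking \<open>S\<close> and \<open>I\<close> as arbitrary bounds on the ratios, not as
  extrema, lets one lemma serve the general estimate, the case of equal eigenfunctions with
  \<open>I\<close> equal to 1, and that case with the matrices exchanged.\<close>

lemma jacobi_gap_comparison:
  fixes E :: "'e set" and ends :: "'e \<Rightarrow> 'v::finite uprod"
  defines "J \<equiv> jacobi_matrix E ends"
  assumes fin: "finite E" and a: "\<forall>e\<in>E. a e > 0" "\<forall>e\<in>E. a' e > 0"
    and psi: "normalized_perron (J a b) \<psi>" "normalized_perron (J a' b') \<psi>'"
    and S: "0 \<le> S"
      "\<And>e v w. e \<in> E \<Longrightarrow> ends e = Upair v w \<Longrightarrow>
        (a e * \<psi> $ v * \<psi> $ w) / (a' e * \<psi>' $ v * \<psi>' $ w) \<le> S"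
    and I: "0 < I" "\<And>v. I \<le> (\<psi> $ v)\<^sup>2 / (\<psi>' $ v)\<^sup>2"
    and k: "k \<in> {1..CARD('v)}"
  shows "nth_eigenvalue 1 (J a b) - nth_eigenvalue k (J a b)
    \<le> S / I * (nth_eigenvalue 1 (J a' b') - nth_eigenvalue k (J a' b'))"
proof (rule spectral_gap_comparison[where \<psi> = \<psi> and \<psi>' = \<psi>'])
  have pos: "\<psi> $ v > 0" "\<psi>' $ v > 0" for v
    using psi by (auto simp: normalized_perron_def)
  then show "\<psi> $ v > 0" "\<psi>' $ v > 0" for v .
  show "J a b *v \<psi> = nth_eigenvalue 1 (J a b) *\<^sub>R \<psi>"
    "J a' b' *v \<psi>' = nth_eigenvalue 1 (J a' b') *\<^sub>R \<psi>'"
    using psi by (auto simp: normalized_perron_def eigenspace_def)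
  show "J a b $ v $ w * \<psi> $ v * \<psi> $ w \<le> S * (J a' b' $ v $ w * \<psi>' $ v * \<psi>' $ w)"
    if "v \<noteq> w" for v w
  proof -
    \<comment> \<open>An off-diagonal entry is a sum over parallel edges, so the bound for single
      edges sums to one for the entry.\<close>
    have "a e * \<psi> $ v * \<psi> $ w \<le> S * (a' e * \<psi>' $ v * \<psi>' $ w)"
      if "e \<in> E" "ends e = Upair v w" for e
      using S(2)[OF that] that(1) a pos[of v] pos[of w] by (simp add: pos_divide_le_eq)
    then have "(\<Sum>e | e \<in> E \<and> ends e = Upair v w. a e * \<psi> $ v * \<psi> $ w)
        \<le> (\<Sum>e | e \<in> E \<and> ends e = Upair v w. S * (a' e * \<psi>' $ v * \<psi>' $ w))"
      by (intro sum_mono) auto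
    then show ?thesis
      using that by (simp add: J_def jacobi_matrix_def sum_distrib_left sum_distrib_right mult_ac)
  qed
  show "I * (\<psi>' $ v)\<^sup>2 \<le> (\<psi> $ v)\<^sup>2" for v
    using I(2)[of v] pos(2)[of v] by (simp add: pos_le_divide_eq)
qed (use k S(1) I(1) in \<open>simp_all add: J_def transpose_jacobi_matrix\<close>)

section \<open>From arbitrary bounds to extremal ratios\<close>

text \<open>Guarantees that the extrema over edges are taken over nonempty sets as soon as an index
  \<open>k \<noteq> 1\<close> exists.\<close>

lemma (in finite_connected_graph) edges_nonempty:
  assumes "CARD('v) \<noteq> 1"
  shows "E \<noteq> {}"
proof
  assume "E = {}"
  then have "graph_adj E ends = {}"
    by (simp add: graph_adj_def)
  then have "v = w" for v w :: 'v
    using connected[of v w] by simp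
  then have "(UNIV :: 'v set) = {undefined}"
    by auto
  then show False
    using assms by (metis One_nat_def card.empty card.insert empty_iff finite.emptyI)
qed

theorem theorem3p2:
  fixes E :: "'e set" and ends :: "'e \<Rightarrow> 'v::finite uprod"
    and a a' :: "'e \<Rightarrow> real" and b b' :: "'v \<Rightarrow> real"
    and J J' :: "real^'v^'v" and \<psi> \<psi>' :: "real^'v" and S I :: real
  assumes "finite_connected_graph E ends"
    and "\<forall>e\<in>E. a e > 0" and "\<forall>e\<in>E. a' e > 0"
    and "J = jacobi_matrix E ends a b" and "J' = jacobi_matrix E ends a' b'"
    and "normalized_perron J \<psi>" and "normalized_perron J' \<psi>'"
    and "S = Max {(a e * \<psi> $ v * \<psi> $ w) / (a' e * \<psi>' $ v * \<psi>' $ w) | e v w.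
                    e \<in> E \<and> ends e = Upair v w}"
    and "I = Min {(\<psi> $ v)\<^sup>2 / (\<psi>' $ v)\<^sup>2 | v. v \<in> UNIV}"
  shows "(\<forall>k\<in>{1..CARD('v)}.
            nth_eigenvalue 1 J - nth_eigenvalue k J
              \<le> S / I * (nth_eigenvalue 1 J' - nth_eigenvalue k J')) \<and>
         ((\<exists>c>0. \<psi> = c *\<^sub>R \<psi>') \<longrightarrow>
          (\<forall>k\<in>{1..CARD('v)}.
             Min {a e / a' e | e. e \<in> E} * (nth_eigenvalue 1 J' - nth_eigenvalue k J')
               \<le> nth_eigenvalue 1 J - nth_eigenvalue k J \<and>
             nth_eigenvalue 1 J - nth_eigenvalue k J
               \<le> Max {a e / a' e | e. e \<in> E} * (nth_eigenvalue 1 J' - nth_eigenvalue k J')))"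
proof (intro conjI impI ballI)
  have fin: "finite E"
    using assms(1) by (simp add: finite_connected_graph_def)
  have J: "normalized_perron (jacobi_matrix E ends a b) \<psi>"
    and J': "normalized_perron (jacobi_matrix E ends a' b') \<psi>'"
    using assms(4-7) by simp_all
  have pos: "\<psi> $ v > 0" "\<psi>' $ v > 0" for v
    using assms(6,7) by (auto simp: normalized_perron_def)
  let ?S = "{(a e * \<psi> $ v * \<psi> $ w) / (a' e * \<psi>' $ v * \<psi>' $ w) | e v w.
                    e \<in> E \<and> ends e = Upair v w}"
  have nonempty: "E \<noteq> {}" if "k \<in> {1..CARD('v)}" "k \<noteq> 1" for k
    using finite_connected_graph.edges_nonempty[OF assms(1)] that by auto
  have finS: "finite ?S"
    using fin
    by (intro finite_subset[of ?S "\<Union>e\<in>E. \<Union>v. \<Union>w.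
          {(a e * \<psi> $ v * \<psi> $ w) / (a' e * \<psi>' $ v * \<psi>' $ w)}"]) (blast, simp)
  have S_ge: "(a e * \<psi> $ v * \<psi> $ w) / (a' e * \<psi>' $ v * \<psi>' $ w) \<le> S"
    if "e \<in> E" "ends e = Upair v w" for e v w
    unfolding assms(8) using finS that by (intro Max_ge) auto
  have S_nonneg: "0 \<le> S" if ne: "E \<noteq> {}"
  proof -
    obtain e where "e \<in> E"
      using ne by blast
    moreover obtain v w where "ends e = Upair v w"
      by (cases "ends e") auto
    ultimately have "0 \<le> (a e * \<psi> $ v * \<psi> $ w) / (a' e * \<psi>' $ v * \<psi>' $ w)"
      using assms(2,3) pos by (simp add: less_imp_le)
    with S_ge[OF \<open>e \<in> E\<close> \<open>ends e = Upair v w\<close>] show ?thesis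
      by linarith
  qed
  have I: "I = Min (range (\<lambda>v. (\<psi> $ v)\<^sup>2 / (\<psi>' $ v)\<^sup>2))"
    unfolding assms(9) by (rule arg_cong[of _ _ Min]) auto
  have I_le: "I \<le> (\<psi> $ v)\<^sup>2 / (\<psi>' $ v)\<^sup>2" for v
    unfolding I by (intro Min_le) auto
  have I_pos: "0 < I"
    unfolding I using pos by (subst Min_gr_iff) (auto simp: less_imp_neq[THEN not_sym])
  show "nth_eigenvalue 1 J - nth_eigenvalue k J
      \<le> S / I * (nth_eigenvalue 1 J' - nth_eigenvalue k J')" if k: "k \<in> {1..CARD('v)}" for k
  \<comment> \<open>For \<open>k = 1\<close> both sides are 0. This covers the single vertex without
    edges, where \<open>S\<close> is the unspecified \<open>Max\<close> of an empty set; any other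
    \<open>k\<close> forces a second vertex and hence an edge.\<close>
  proof (cases "k = 1")
    case False
    show ?thesis
      unfolding assms(4,5)
      by (rule jacobi_gap_comparison[OF fin assms(2,3) J J'])
        (rule S_nonneg[OF nonempty[OF k False]], erule S_ge, assumption, rule I_pos, rule I_le, rule k)
  qed simp
  let ?r = "{a e / a' e | e. e \<in> E}"
  have r: "?r = (\<lambda>e. a e / a' e) ` E"
    by auto
  fix k
  assume "\<exists>c>0. \<psi> = c *\<^sub>R \<psi>'" and k: "k \<in> {1..CARD('v)}"
  \<comment> \<open>Both eigenfunctions have norm 1 and \<open>c\<close> is positive, so
    \<open>c\<close> is 1.\<close>
  then have eq: "\<psi> = \<psi>'"
    using assms(6,7) by (auto simp: normalized_perron_def)
  have ge: "a e / a' e \<le> Max ?r" and le: "Min ?r \<le> a e / a' e" if "e \<in> E" for e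
    unfolding r using that fin by auto
  have Max_nonneg: "0 \<le> Max ?r" and Min_pos: "0 < Min ?r" if k1: "k \<noteq> 1"
  proof -
    show *: "0 < Min ?r"
      unfolding r using nonempty[OF k k1] fin assms(2,3) by (subst Min_gr_iff) auto
    obtain e where "e \<in> E"
      using nonempty[OF k k1] by blast
    then show "0 \<le> Max ?r"
      using * ge[of e] le[of e] by linarith
  qed
  \<comment> \<open>With equal eigenfunctions the edge ratios reduce to \<open>a e / a' e\<close>
    and the vertex ratios to 1.\<close>
  have cancel: "(x * \<psi> $ v * \<psi> $ w) / (y * \<psi> $ v * \<psi> $ w) = x / y" for x y v w
    using pos(1)[of v] pos(1)[of w] by simp
  have one: "(1::real) \<le> (\<psi> $ v)\<^sup>2 / (\<psi> $ v)\<^sup>2" for v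
    using pos(1)[of v] by simp
  show "nth_eigenvalue 1 J - nth_eigenvalue k J
      \<le> Max ?r * (nth_eigenvalue 1 J' - nth_eigenvalue k J')"
  proof (cases "k = 1")
    case False
    have "nth_eigenvalue 1 J - nth_eigenvalue k J
        \<le> Max ?r / 1 * (nth_eigenvalue 1 J' - nth_eigenvalue k J')"
      unfolding assms(4,5)
    proof (rule jacobi_gap_comparison[OF fin assms(2,3) J J'[folded eq] Max_nonneg[OF False] _ _ one k])
      show "(a e * \<psi> $ v * \<psi> $ w) / (a' e * \<psi> $ v * \<psi> $ w) \<le> Max ?r" if "e \<in> E" for e v w
        unfolding cancel by (rule ge[OF that])
    qed simp
    then show ?thesis
      by simp
  qed simp
  show "Min ?r * (nth_eigenvalue 1 J' - nth_eigenvalue k J')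
      \<le> nth_eigenvalue 1 J - nth_eigenvalue k J"
  proof (cases "k = 1")
    case False
    note m = Min_pos[OF False]
    \<comment> \<open>Exchanging the two matrices inverts the edge ratios, so the reciprocal of the
      minimum takes the place of the maximum.\<close>
    have "a' e / a e \<le> inverse (Min ?r)" if "e \<in> E" for e
      using le_imp_inverse_le[OF le[OF that] m] by simp
    then have *: "(a' e * \<psi> $ v * \<psi> $ w) / (a e * \<psi> $ v * \<psi> $ w) \<le> inverse (Min ?r)"
      if "e \<in> E" for e v w
      unfolding cancel using that .
    have "nth_eigenvalue 1 J' - nth_eigenvalue k J'
        \<le> inverse (Min ?r) / 1 * (nth_eigenvalue 1 J - nth_eigenvalue k J)"
      unfolding assms(4,5)
      by (rule jacobi_gap_comparison[OF fin assms(3,2) J'[folded eq] J _ * _ one k])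
        (use m in simp_all)
    then have "nth_eigenvalue 1 J' - nth_eigenvalue k J'
        \<le> (nth_eigenvalue 1 J - nth_eigenvalue k J) / Min ?r"
      by (simp only: div_by_1 divide_inverse[of _ "Min ?r"] mult.commute)
    then show ?thesis
      using m by (simp only: pos_le_divide_eq mult.commute)
  qed simp
qed

end
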